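(* Let $f_l\colon\mathbb{R}^n\to\mathbb{R}$ $(l=1,\ldots,p)$ and $g_i\colon\mathbb{R}^n\to\mathbb{R}$ $(i=1,\ldots,m)$ be convex and let $h_j\colon\mathbb{R}^n\to\mathbb{R}$ $(j=1,\ldots,r)$ be affine. Let $\mathcal{F}=\{x\in\mathbb{R}^n : g_i(x)\le 0\ (i=1,\ldots,m),\ h_j(x)=0\ (j=1,\ldots,r)\}$ and let $\bar x\in\mathcal{F}$. If $\bar x$ satisfies the conditions AKKT$'$ and SCZ with respect to some sequences $\{x^k\}\subset\mathbb{R}^n$ and $\{(\lambda^k,\mu^k,\tau^k)\}\subset\mathbb{R}^p_+\times\mathbb{R}^m_+\times\mathbb{R}^r$, then $\bar x$ is a (global) weak efficient solution of the problem of minimizing $f=(f_1,\ldots,f_p)$ over $\mathcal{F}$ with respect to $\mathbb{R}^p_+$, i.e. there is no $x\in\mathcal{F}$ with $f_l(x)<f_l(\bar x)$ for all $l=1,\ldots,p$.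
   Context: $\mathbb{R}^n$ carries the Euclidean inner product and norm; $\mathbb{R}^p_+$ is the nonnegative orthant of $\mathbb{R}^p$; $\mathbb{N}=\{1,2,\ldots\}$. Subdifferential. For $S\subset\mathbb{R}^n$, $x\in S$ and $\varepsilon\ge 0$, the set of $\varepsilon$-normals is $\widehat N_\varepsilon(x;S)=\{z^*\in\mathbb{R}^n : \limsup_{u\to x,\,u\in S}\frac{\langle z^*,u-x\rangle}{\|u-x\|}\le\varepsilon\}$. For $\bar x\in\mathrm{cl}\,S$, the Mordukhovich (limiting) normal cone $N(\bar x;S)$ is the set of all $z^*\in\mathbb{R}^n$ for which there are $x^k\in S$ with $x^k\to\bar x$, $\varepsilon_k\to0^+$ and $z_k^*\to z^*$ with $z^*_k\in\widehat N_{\varepsilon_k}(x^k;S)$ for all $k$. For $\varphi\colon\mathbb{R}^n\to\mathbb{R}$, the Mordukhovich (limiting) subdifferential at $\bar x$ is $\partial\varphi(\bar x)=\{x^*\in\mathbb{R}^n : (x^*,-1)\in N((\bar x,\varphi(\bar x));\mathrm{epi}\,\varphi)\}$, where $\mathrm{epi}\,\varphi=\{(x,\alpha)\in\mathbb{R}^n\times\mathbb{R} : \alpha\ge\varphi(x)\}$. (For convex $\varphi$ this is the usual convex subdifferential.) AKKT$'$ condition (for continuously differentiable $h_j$). $\bar x\in\mathcal{F}$ satisfies AKKT$'$ with respect to $\{x^k\}\subset\mathbb{R}^n$ and $\{(\lambda^k,\mu^k,\tau^k)\}\subset\mathbb{R}^p_+\times\mathbb{R}^m_+\times\mathbb{R}^r$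 if: (A0) $x^k\to\bar x$; (A1)$'$ $\mathfrak{m}'(x^k;\lambda^k,\mu^k,\tau^k)\to0$ as $k\to\infty$, where $\mathfrak{m}'(x^k;\lambda^k,\mu^k,\tau^k)$ is the infimum of $\big\|\sum_{l=1}^p\lambda_l^k\xi_l+\sum_{i=1}^m\mu_i^k\eta_i+\sum_{j=1}^r\tau_j^k\nabla h_j(x^k)\big\|$ over all $\xi_l\in\partial f_l(x^k)$, $\eta_i\in\partial g_i(x^k)$; (A2) $\sum_{l=1}^p\lambda_l^k=1$ for all $k$; (A3) for each $i\in\{1,\ldots,m\}$ with $g_i(\bar x)<0$, $\mu_i^k=0$ for all sufficiently large $k$. SCZ (sum converging to zero) condition with respect to these sequences: $\sum_{i=1}^m\mu_i^kg_i(x^k)+\sum_{j=1}^r\tau_j^kh_j(x^k)\to0$ as $k\to\infty$. *)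

theory Defs
  imports "HOL-Analysis.Analysis"
begin

text \<open>
  Families indexed by \<open>1, \<dots>, q\<close> are functions on \<^typ>\<open>nat\<close> of which only the values on
  \<open>{1..q}\<close> are used; this covers the cases without inequality or without equality constraints
  (\<open>m = 0\<close>, \<open>r = 0\<close>). Sequences are indexed from \<open>0\<close>, and \<open>lam k l\<close> stands for
  \<open>\<lambda>\<^sub>l\<^sup>k\<close>; likewise for \<open>mu\<close> and \<open>tau\<close>.
\<close>

subsection \<open>Limiting normal cone and limiting subdifferential\<close>

text \<open>The filter \<open>at x within S\<close> omits \<open>x\<close> itself, so the quotient is never evaluated at \<open>u = x\<close>.\<close>

definition eps_normals :: "real \<Rightarrow> 'a::euclidean_space \<Rightarrow> 'a set \<Rightarrow> 'a set" where
  "eps_normals \<epsilon> x S =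
    {z. Limsup (at x within S) (\<lambda>u. ereal (inner z (u - x) / norm (u - x))) \<le> ereal \<epsilon>}"

definition limiting_normal_cone :: "'a::euclidean_space \<Rightarrow> 'a set \<Rightarrow> 'a set" where
  "limiting_normal_cone x S =
    {z. \<exists>(X :: nat \<Rightarrow> 'a) (\<epsilon> :: nat \<Rightarrow> real) (Z :: nat \<Rightarrow> 'a).
          (\<forall>k. X k \<in> S) \<and> X \<longlonglongrightarrow> x \<and>
          (\<forall>k. 0 < \<epsilon> k) \<and> \<epsilon> \<longlonglongrightarrow> 0 \<and>
          Z \<longlonglongrightarrow> z \<and>
          (\<forall>k. Z k \<in> eps_normals (\<epsilon> k) (X k) S)}"

definition limiting_subdifferential :: "('a::euclidean_space \<Rightarrow> real) \<Rightarrow> 'a \<Rightarrow> 'a set" where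
  "limiting_subdifferential \<phi> x = {v. (v, -1) \<in> limiting_normal_cone (x, \<phi> x) (epigraph UNIV \<phi>)}"

subsection \<open>Gradients and affine functions\<close>

text \<open>Meaningful only where \<open>h\<close> is differentiable; the gradient is then unique.\<close>

definition grad :: "('a::euclidean_space \<Rightarrow> real) \<Rightarrow> 'a \<Rightarrow> 'a" where
  "grad h x = (THE D. GDERIV h x :> D)"

definition affine_function :: "('a::real_vector \<Rightarrow> real) \<Rightarrow> bool" where
  "affine_function h \<longleftrightarrow> (\<exists>L c. linear L \<and> (\<forall>x. h x = L x + c))"

subsection \<open>The optimization problem and the sequential conditions\<close>

definition feasible_set ::
  "nat \<Rightarrow> nat \<Rightarrow> (nat \<Rightarrow> 'a \<Rightarrow> real) \<Rightarrow> (nat \<Rightarrow> 'a \<Rightarrow> real) \<Rightarrow> 'a set" where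
  "feasible_set m r g h = {x. (\<forall>i\<in>{1..m}. g i x \<le> 0) \<and> (\<forall>j\<in>{1..r}. h j x = 0)}"

definition weak_efficient :: "nat \<Rightarrow> (nat \<Rightarrow> 'a \<Rightarrow> real) \<Rightarrow> 'a set \<Rightarrow> 'a \<Rightarrow> bool" where
  "weak_efficient p f F xbar \<longleftrightarrow>
    xbar \<in> F \<and> \<not> (\<exists>x\<in>F. \<forall>l\<in>{1..p}. f l x < f l xbar)"

text \<open>The infimum is taken in \<^typ>\<open>ereal\<close>, so that it is \<open>\<infinity>\<close> if one of the subdifferentials is empty.\<close>

definition akkt_residual ::
  "nat \<Rightarrow> nat \<Rightarrow> nat \<Rightarrow> (nat \<Rightarrow> 'a::euclidean_space \<Rightarrow> real) \<Rightarrow> (nat \<Rightarrow> 'a \<Rightarrow> real) \<Rightarrow>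
    (nat \<Rightarrow> 'a \<Rightarrow> real) \<Rightarrow> 'a \<Rightarrow> (nat \<Rightarrow> real) \<Rightarrow> (nat \<Rightarrow> real) \<Rightarrow> (nat \<Rightarrow> real) \<Rightarrow> ereal" where
  "akkt_residual p m r f g h x lam mu tau =
    Inf {ereal (norm ((\<Sum>l=1..p. lam l *\<^sub>R \<xi> l) + (\<Sum>i=1..m. mu i *\<^sub>R \<eta> i)
                     + (\<Sum>j=1..r. tau j *\<^sub>R grad (h j) x))) | \<xi> \<eta>.
          (\<forall>l\<in>{1..p}. \<xi> l \<in> limiting_subdifferential (f l) x) \<and>
          (\<forall>i\<in>{1..m}. \<eta> i \<in> limiting_subdifferential (g i) x)}"

definition AKKT' ::
  "nat \<Rightarrow> nat \<Rightarrow> nat \<Rightarrow> (nat \<Rightarrow> 'a::euclidean_space \<Rightarrow> real) \<Rightarrow> (nat \<Rightarrow> 'a \<Rightarrow> real) \<Rightarrow>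
    (nat \<Rightarrow> 'a \<Rightarrow> real) \<Rightarrow> 'a \<Rightarrow> (nat \<Rightarrow> 'a) \<Rightarrow> (nat \<Rightarrow> nat \<Rightarrow> real) \<Rightarrow> (nat \<Rightarrow> nat \<Rightarrow> real) \<Rightarrow>
    (nat \<Rightarrow> nat \<Rightarrow> real) \<Rightarrow> bool" where
  "AKKT' p m r f g h xbar x lam mu tau \<longleftrightarrow>
    xbar \<in> feasible_set m r g h \<and>
    (\<forall>k. \<forall>l\<in>{1..p}. 0 \<le> lam k l) \<and>
    (\<forall>k. \<forall>i\<in>{1..m}. 0 \<le> mu k i) \<and>
    x \<longlonglongrightarrow> xbar \<and>
    (\<lambda>k. akkt_residual p m r f g h (x k) (lam k) (mu k) (tau k)) \<longlonglongrightarrow> 0 \<and>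
    (\<forall>k. (\<Sum>l=1..p. lam k l) = 1) \<and>
    (\<forall>i\<in>{1..m}. g i xbar < 0 \<longrightarrow> (\<forall>\<^sub>F k in sequentially. mu k i = 0))"

definition SCZ ::
  "nat \<Rightarrow> nat \<Rightarrow> (nat \<Rightarrow> 'a \<Rightarrow> real) \<Rightarrow> (nat \<Rightarrow> 'a \<Rightarrow> real) \<Rightarrow> (nat \<Rightarrow> 'a) \<Rightarrow>
    (nat \<Rightarrow> nat \<Rightarrow> real) \<Rightarrow> (nat \<Rightarrow> nat \<Rightarrow> real) \<Rightarrow> bool" where
  "SCZ m r g h x mu tau \<longleftrightarrow>
    (\<lambda>k. (\<Sum>i=1..m. mu k i * g i (x k)) + (\<Sum>j=1..r. tau k j * h j (x k))) \<longlonglongrightarrow> 0"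

end

theory Submission
  imports Defs
begin

text \<open>
  A limiting subgradient of a convex function is an ordinary subgradient, and an affine \<open>h\<close> satisfies
  \<open>h y = h x + \<langle>\<nabla>h x, y - x\<rangle>\<close>. Hence the Lagrangian with multipliers
  \<open>(\<lambda>\<^sup>k, \<mu>\<^sup>k, \<tau>\<^sup>k)\<close> has at \<open>x\<^sup>k\<close> an affine minorant whose slope \<open>w\<^sup>k\<close> can be chosen with
  \<open>w\<^sup>k \<rightarrow> 0\<close>. If a feasible \<open>y\<close> had \<open>f\<^sub>l y < f\<^sub>l xbar\<close> for all \<open>l\<close>, evaluating this minorant
  at \<open>y\<close> and using SCZ would give
  \<open>\<Sum>\<^sub>l \<lambda>\<^sub>l\<^sup>k (f\<^sub>l y - f\<^sub>l x\<^sup>k) \<ge> o(1)\<close>; but the left-hand side is eventually below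
  a fixed negative number, since the weights \<open>\<lambda>\<^sub>l\<^sup>k\<close> sum to \<open>1\<close>.
\<close>

text \<open>Convexity keeps the segment from \<open>x\<close> to \<open>u\<close> inside
  \<open>S\<close>, and the quotient is constant along it. A quotient \<open>c > \<epsilon>\<close>
  at \<open>u\<close> would thus recur arbitrarily close to \<open>x\<close>, against the limsup
  bound.\<close>

lemma eps_normals_convex:
  fixes S :: "'a::euclidean_space set"
  assumes "convex S" "x \<in> S" "u \<in> S" "z \<in> eps_normals \<epsilon> x S"
  shows "inner z (u - x) \<le> \<epsilon> * norm (u - x)"
proof (rule ccontr)
  assume neg: "\<not> ?thesis"
  then have ux: "u \<noteq> x" by auto
  then have pos: "norm (u - x) > 0" by simp
  define c where "c = inner z (u - x) / norm (u - x)"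
  have "c > \<epsilon>" using neg pos by (simp add: c_def field_simps)
  moreover have "Limsup (at x within S) (\<lambda>u. ereal (inner z (u - x) / norm (u - x))) \<le> ereal \<epsilon>"
    using assms(4) by (simp add: eps_normals_def)
  ultimately have "Limsup (at x within S) (\<lambda>u. ereal (inner z (u - x) / norm (u - x))) < ereal c"
    by (meson le_less_trans less_ereal.simps(1))
  then have "\<forall>\<^sub>F v in at x within S. ereal (inner z (v - x) / norm (v - x)) < ereal c"
    by (rule Limsup_lessD)
  then obtain d where d: "d > 0"
    "\<And>v. v \<in> S \<Longrightarrow> v \<noteq> x \<Longrightarrow> dist v x < d \<Longrightarrow> inner z (v - x) / norm (v - x) < c"
    by (auto simp: eventually_at)
  \<comment> \<open>The cap \<open>1\<close> makes \<open>v\<close> a convex combination; the other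
    bound puts \<open>v\<close> within \<open>d / 2\<close> of \<open>x\<close>.\<close>
  define t where "t = min 1 (d / (2 * norm (u - x)))"
  have t: "0 < t" "t \<le> 1" using d pos by (auto simp: t_def)
  define v where "v = (1 - t) *\<^sub>R x + t *\<^sub>R u"
  have vx: "v - x = t *\<^sub>R (u - x)" by (simp add: v_def algebra_simps)
  have "v \<in> S" unfolding v_def using assms t by (intro convexD) auto
  moreover have "v \<noteq> x" using vx t ux by auto
  moreover have "t * norm (u - x) \<le> d / (2 * norm (u - x)) * norm (u - x)"
    using pos by (intro mult_right_mono) (auto simp: t_def)
  then have "dist v x < d" using vx t d pos by (simp add: dist_norm)
  ultimately have "inner z (v - x) / norm (v - x) < c" by (rule d(2))
  moreover have "inner z (v - x) / norm (v - x) = c"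
    unfolding vx c_def using t(1) by simp
  ultimately show False by simp
qed

text \<open>The previous bound passes to the limit along the defining sequences: its error
  \<open>\<epsilon> k * norm (u - X k)\<close> vanishes because \<open>X\<close> converges.\<close>

lemma limiting_normal_cone_convex:
  fixes S :: "'a::euclidean_space set"
  assumes "convex S" "u \<in> S" "z \<in> limiting_normal_cone x S"
  shows "inner z (u - x) \<le> 0"
proof -
  obtain X \<epsilon> Z where X: "\<And>k. X k \<in> S" "X \<longlonglongrightarrow> x" "\<epsilon> \<longlonglongrightarrow> 0" "Z \<longlonglongrightarrow> z"
    and Z: "\<And>k. Z k \<in> eps_normals (\<epsilon> k) (X k) S"
    using assms(3) unfolding limiting_normal_cone_def by blast
  have "(\<lambda>k. inner (Z k) (u - X k)) \<longlonglongrightarrow> inner z (u - x)"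
    using X by (intro tendsto_intros)
  moreover have "(\<lambda>k. \<epsilon> k * norm (u - X k)) \<longlonglongrightarrow> 0 * norm (u - x)"
    using X by (intro tendsto_intros)
  ultimately have "inner z (u - x) \<le> 0 * norm (u - x)"
    using eps_normals_convex[OF assms(1) X(1) assms(2) Z] by (intro LIMSEQ_le) blast+
  then show ?thesis by simp
qed

text \<open>\<open>(v, -1)\<close> is normal to the convex epigraph at \<open>(x, \<phi> x)\<close>;
  testing it against \<open>(y, \<phi> y)\<close> is the subgradient inequality.\<close>

lemma limiting_subdifferential_convex:
  fixes \<phi> :: "'a::euclidean_space \<Rightarrow> real"
  assumes "convex_on UNIV \<phi>" "v \<in> limiting_subdifferential \<phi> x"
  shows "\<phi> x + inner v (y - x) \<le> \<phi> y"
proof -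
  have "inner (v, -1::real) ((y, \<phi> y) - (x, \<phi> x)) \<le> 0"
    using assms by (intro limiting_normal_cone_convex[where S = "epigraph UNIV \<phi>"])
      (auto simp: convex_epigraph limiting_subdifferential_def mem_epigraph)
  then show ?thesis by (simp add: algebra_simps)
qed

lemma affine_function_grad:
  fixes h :: "'a::euclidean_space \<Rightarrow> real"
  assumes "affine_function h"
  shows "h y = h x + inner (grad h x) (y - x)"
proof -
  obtain L c where L: "linear L" "\<And>x. h x = L x + c"
    using assms unfolding affine_function_def by auto
  \<comment> \<open>The Riesz vector of the linear part.\<close>
  define D where "D = adjoint L 1"
  have LD: "L z = inner z D" for z
    using adjoint_works[OF L(1), of z 1] by (simp add: D_def)
  have "GDERIV h x :> D"
    unfolding gderiv_def L(2) LD by (auto intro!: derivative_eq_intros)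
  moreover have "E = D" if "GDERIV h x :> E" for E
  proof -
    have "(\<lambda>z. inner z E) = (\<lambda>z. inner z D)"
      using that \<open>GDERIV h x :> D\<close> unfolding gderiv_def by (rule has_derivative_unique)
    then have "inner (E - D) E = inner (E - D) D" by (rule fun_cong)
    then have "inner (E - D) (E - D) = 0" by (simp add: inner_diff_right)
    then show ?thesis by simp
  qed
  ultimately have "grad h x = D"
    unfolding grad_def by (rule the_equality[where P = "\<lambda>D. GDERIV h x :> D"])
  then show ?thesis by (simp add: L(2) LD inner_diff_right inner_commute)
qed

text \<open>Weighted subgradient inequalities add up to an affine minorant with slope
  \<open>w\<close>, and Cauchy-Schwarz bounds its linear term by
  \<open>d * norm (y - x)\<close>.\<close>

lemma lagrangian_minorant:
  fixes f g h :: "nat \<Rightarrow> 'a::euclidean_space \<Rightarrow> real"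
  assumes f: "\<And>l. l \<in> {1..p} \<Longrightarrow> convex_on UNIV (f l)"
    and g: "\<And>i. i \<in> {1..m} \<Longrightarrow> convex_on UNIV (g i)"
    and h: "\<And>j. j \<in> {1..r} \<Longrightarrow> affine_function (h j)"
    and lam: "\<And>l. l \<in> {1..p} \<Longrightarrow> 0 \<le> lam l"
    and mu: "\<And>i. i \<in> {1..m} \<Longrightarrow> 0 \<le> mu i"
    and res: "akkt_residual p m r f g h x lam mu tau < ereal d"
  shows "(\<Sum>l=1..p. lam l * f l x) + (\<Sum>i=1..m. mu i * g i x) + (\<Sum>j=1..r. tau j * h j x)
      - d * norm (y - x)
    \<le> (\<Sum>l=1..p. lam l * f l y) + (\<Sum>i=1..m. mu i * g i y) + (\<Sum>j=1..r. tau j * h j y)"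
proof -
  \<comment> \<open>An infimum strictly below \<open>d\<close> yields an actual choice of
    subgradients with norm below \<open>d\<close>.\<close>
  obtain \<xi> \<eta> where \<xi>: "\<And>l. l \<in> {1..p} \<Longrightarrow> \<xi> l \<in> limiting_subdifferential (f l) x"
    and \<eta>: "\<And>i. i \<in> {1..m} \<Longrightarrow> \<eta> i \<in> limiting_subdifferential (g i) x"
    and norm: "norm ((\<Sum>l=1..p. lam l *\<^sub>R \<xi> l) + (\<Sum>i=1..m. mu i *\<^sub>R \<eta> i)
                     + (\<Sum>j=1..r. tau j *\<^sub>R grad (h j) x)) < d"
    using res unfolding akkt_residual_def Inf_less_iff bex_simps mem_Collect_eq
    by (elim bexE CollectE exE conjE) (metis (no_types, lifting) less_ereal.simps(1))
  define w where "w = (\<Sum>l=1..p. lam l *\<^sub>R \<xi> l) + (\<Sum>i=1..m. mu i *\<^sub>R \<eta> i)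
                     + (\<Sum>j=1..r. tau j *\<^sub>R grad (h j) x)"
  have "(\<Sum>l=1..p. lam l * (f l x + inner (\<xi> l) (y - x))) \<le> (\<Sum>l=1..p. lam l * f l y)"
    using f lam \<xi> by (intro sum_mono mult_left_mono limiting_subdifferential_convex)
  moreover have "(\<Sum>i=1..m. mu i * (g i x + inner (\<eta> i) (y - x))) \<le> (\<Sum>i=1..m. mu i * g i y)"
    using g mu \<eta> by (intro sum_mono mult_left_mono limiting_subdifferential_convex)
  \<comment> \<open>An equality, since \<open>tau j\<close> may have either sign.\<close>
  moreover have "(\<Sum>j=1..r. tau j * h j y) =
      (\<Sum>j=1..r. tau j * (h j x + inner (grad (h j) x) (y - x)))"
    using affine_function_grad[OF h] by (intro sum.cong) auto
  moreover have "inner w (y - x) = (\<Sum>l=1..p. lam l * inner (\<xi> l) (y - x))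
      + (\<Sum>i=1..m. mu i * inner (\<eta> i) (y - x)) + (\<Sum>j=1..r. tau j * inner (grad (h j) x) (y - x))"
    by (simp add: w_def inner_add_left inner_sum_left)
  moreover have "\<bar>inner w (y - x)\<bar> \<le> d * norm (y - x)"
    using Cauchy_Schwarz_ineq2[of w "y - x"] norm mult_right_mono[of "norm w" d "norm (y - x)"]
    by (simp add: w_def)
  ultimately show ?thesis by (simp add: distrib_left sum.distrib)
qed

theorem theorem3p2:
  fixes f g h :: "nat \<Rightarrow> real ^ 'n \<Rightarrow> real"
    and p m r :: nat
    and xbar :: "real ^ 'n"
  assumes "p \<ge> 1"
    and "\<And>l. l \<in> {1..p} \<Longrightarrow> convex_on UNIV (f l)"
    and "\<And>i. i \<in> {1..m} \<Longrightarrow> convex_on UNIV (g i)"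
    and "\<And>j. j \<in> {1..r} \<Longrightarrow> affine_function (h j)"
    and "xbar \<in> feasible_set m r g h"
    and "\<exists>x lam mu tau. AKKT' p m r f g h xbar x lam mu tau \<and> SCZ m r g h x mu tau"
  shows "weak_efficient p f (feasible_set m r g h) xbar"
  unfolding weak_efficient_def
proof (intro conjI notI)
  show "xbar \<in> feasible_set m r g h" by fact
next
  assume "\<exists>y\<in>feasible_set m r g h. \<forall>l\<in>{1..p}. f l y < f l xbar"
  then obtain y where gy: "\<And>i. i \<in> {1..m} \<Longrightarrow> g i y \<le> 0" and hy: "\<And>j. j \<in> {1..r} \<Longrightarrow> h j y = 0"
    and less: "\<And>l. l \<in> {1..p} \<Longrightarrow> f l y < f l xbar"
    unfolding feasible_set_def by blast
  obtain x lam mu tau where akkt: "AKKT' p m r f g h xbar x lam mu tau"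
    and scz: "SCZ m r g h x mu tau"
    using assms(6) by blast
  have lam: "\<And>k l. l \<in> {1..p} \<Longrightarrow> 0 \<le> lam k l" and mu: "\<And>k i. i \<in> {1..m} \<Longrightarrow> 0 \<le> mu k i"
    and x: "x \<longlonglongrightarrow> xbar" and lam1: "\<And>k. (\<Sum>l=1..p. lam k l) = 1"
    and res: "(\<lambda>k. akkt_residual p m r f g h (x k) (lam k) (mu k) (tau k)) \<longlonglongrightarrow> 0"
    using akkt unfolding AKKT'_def by auto
  \<comment> \<open>The smallest decrease among the objectives; \<open>p \<ge> 1\<close> makes the
    minimum one over a nonempty set.\<close>
  define \<delta> where "\<delta> = Min ((\<lambda>l. f l xbar - f l y) ` {1..p})"
  have \<delta>: "\<delta> > 0" using less assms(1) by (simp add: \<delta>_def)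
  have \<delta>_le: "\<delta> \<le> f l xbar - f l y" if "l \<in> {1..p}" for l
    unfolding \<delta>_def using that by (intro Min_le) auto
  \<comment> \<open>Chosen so that the slope error \<open>d * norm (y - x k)\<close> is eventually
    at most \<open>\<delta> / 4\<close>; the \<open>+ 1\<close> absorbs the move from
    \<open>xbar\<close> to \<open>x k\<close>.\<close>
  define d where "d = \<delta> / (4 * (norm (y - xbar) + 1))"
  have d: "d > 0" using \<delta> by (auto simp: d_def intro!: divide_pos_pos add_nonneg_pos)
  have "\<forall>\<^sub>F k in sequentially. akkt_residual p m r f g h (x k) (lam k) (mu k) (tau k) < ereal d"
    by (rule order_tendstoD[OF res]) (use d in simp)
  moreover have "(\<lambda>k. norm (y - x k)) \<longlonglongrightarrow> norm (y - xbar)"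
    using x by (intro tendsto_intros)
  then have "\<forall>\<^sub>F k in sequentially. norm (y - x k) < norm (y - xbar) + 1"
    by (rule order_tendstoD) simp
  moreover have "\<forall>\<^sub>F k in sequentially.
      - \<delta> / 4 < (\<Sum>i=1..m. mu k i * g i (x k)) + (\<Sum>j=1..r. tau k j * h j (x k))"
    by (rule order_tendstoD[OF scz[unfolded SCZ_def]]) (use \<delta> in simp)
  moreover have "\<forall>\<^sub>F k in sequentially. f l xbar - \<delta> / 2 < f l (x k)" if "l \<in> {1..p}" for l
  proof -
    have "continuous_on UNIV (f l)" using assms(2)[OF that] by (intro convex_on_continuous) auto
    then have "(\<lambda>k. f l (x k)) \<longlonglongrightarrow> f l xbar"
      by (rule continuous_on_tendsto_compose[OF _ x]) auto
    then show ?thesis by (rule order_tendstoD) (use \<delta> in simp)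
  qed
  then have "\<forall>\<^sub>F k in sequentially. \<forall>l\<in>{1..p}. f l xbar - \<delta> / 2 < f l (x k)"
    by (intro eventually_ball_finite) auto
  ultimately have "\<forall>\<^sub>F k in sequentially. False"
  proof eventually_elim
    case (elim k)
    \<comment> \<open>Of the decrease \<open>\<delta>\<close> from \<open>xbar\<close> to
      \<open>y\<close>, continuity costs at most half when \<open>xbar\<close> is replaced by
      \<open>x k\<close>.\<close>
    have "(\<Sum>l=1..p. lam k l * (f l y - f l (x k))) \<le> (\<Sum>l=1..p. lam k l * (- \<delta> / 2))"
      using lam elim(4) \<delta>_le by (intro sum_mono mult_left_mono) force+
    also have "\<dots> = - \<delta> / 2"
      using lam1[of k] by (simp only: sum_distrib_right[symmetric])
    finally have "(\<Sum>l=1..p. lam k l * f l y) - (\<Sum>l=1..p. lam k l * f l (x k)) \<le> - \<delta> / 2"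
      by (simp add: right_diff_distrib sum_subtractf)
    moreover have "(\<Sum>l=1..p. lam k l * f l (x k)) + (\<Sum>i=1..m. mu k i * g i (x k))
        + (\<Sum>j=1..r. tau k j * h j (x k)) - d * norm (y - x k)
      \<le> (\<Sum>l=1..p. lam k l * f l y) + (\<Sum>i=1..m. mu k i * g i y) + (\<Sum>j=1..r. tau k j * h j y)"
      using assms(2-4) lam mu elim(1) by (intro lagrangian_minorant)
    moreover have "(\<Sum>i=1..m. mu k i * g i y) \<le> 0"
      using mu gy by (intro sum_nonpos mult_nonneg_nonpos)
    moreover have "(\<Sum>j=1..r. tau k j * h j y) = 0"
      using hy by (intro sum.neutral) auto
    moreover have "d * norm (y - x k) \<le> d * (norm (y - xbar) + 1)"
      using d elim(2) by (intro mult_left_mono) auto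
    moreover have "d * (norm (y - xbar) + 1) = \<delta> / 4"
      unfolding d_def using add_nonneg_pos[OF norm_ge_zero[of "y - xbar"] zero_less_one]
      by (simp add: field_simps)
    \<comment> \<open>SCZ and the slope error cost at most \<open>\<delta> / 4\<close> each, the
      former strictly, so the weighted change of the objectives exceeds
      \<open>- \<delta> / 2\<close>, against the first bound.\<close>
    ultimately show False using elim(3) by linarith
  qed
  then show False by simp
qed

end
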